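(* A bridgeless graph $G$ is $2$-simultaneous edge colorable if and only if $G$ has a cycle double cover $\mathcal{C}$ with the following properties: (i) every circuit of $\mathcal{C}$ is an even circuit (has even length); (ii) $\mathcal{C}$ can be partitioned into at least $\chi'(G)$ classes such that the union of the circuits in each class is a $2$-regular subgraph; (iii) every circuit in $\mathcal{C}$ has a proper $2$-edge coloring (with colors $1,2$) such that each edge $e\in E(G)$ receives different colors in the two circuits of $\mathcal{C}$ containing it.
   Context: All graphs are finite and simple; $[l]=\{1,\ldots,l\}$. "Bridgeless" means $2$-edge-connected. A circuit is a connected $2$-regular subgraph. Here a cycle double cover of $G$ is a collection (multiset) of circuits of $G$ such that every edge of $G$ lies in exactly two members of the collection. $\chi'(G)$ is the edge chromatic number. A $2$-simultaneous edge coloring of $G$ is a pair $(c_1,c_2)$ of proper edge colorings $c_i:E(G)\to[l]$ with a common color set such that for every vertex $v$ the sets of colors on edges incident to $v$ are the same under $c_1$ and $c_2$, and $c_1(e)\ne c_2(e)$ for every edge $e$; $G$ is $2$-simultaneous edge colorable if such a pair exists for some $l$. *)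

theory Defs
  imports Main "HOL-Library.Disjoint_Sets"
begin

type_synonym 'a ugraph = "'a set \<times> 'a set set"

abbreviation vertices :: "'a ugraph \<Rightarrow> 'a set" where "vertices \<equiv> fst"
abbreviation edges :: "'a ugraph \<Rightarrow> 'a set set" where "edges \<equiv> snd"

definition simple_graph :: "'a ugraph \<Rightarrow> bool" where
  "simple_graph G \<longleftrightarrow> finite (vertices G) \<and> (\<forall>e\<in>edges G. e \<subseteq> vertices G \<and> card e = 2)"

definition subgraph_of :: "'a ugraph \<Rightarrow> 'a ugraph \<Rightarrow> bool" where
  "subgraph_of H G \<longleftrightarrow> simple_graph H \<and> vertices H \<subseteq> vertices G \<and> edges H \<subseteq> edges G"

definition incident_edges :: "'a ugraph \<Rightarrow> 'a \<Rightarrow> 'a set set" where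
  "incident_edges G v = {e \<in> edges G. v \<in> e}"

definition regular_graph :: "nat \<Rightarrow> 'a ugraph \<Rightarrow> bool" where
  "regular_graph k G \<longleftrightarrow> (\<forall>v\<in>vertices G. card (incident_edges G v) = k)"

definition connected_graph :: "'a ugraph \<Rightarrow> bool" where
  "connected_graph G \<longleftrightarrow> vertices G \<noteq> {} \<and>
     (\<forall>u\<in>vertices G. \<forall>v\<in>vertices G. (u, v) \<in> {(x, y). {x, y} \<in> edges G}\<^sup>*)"

text \<open>The one-vertex graph counts as \<open>k\<close>-edge-connected for every \<open>k \<ge> 1\<close>.\<close>

definition edge_connected :: "nat \<Rightarrow> 'a ugraph \<Rightarrow> bool" where
  "edge_connected k G \<longleftrightarrow>
     (\<forall>F \<subseteq> edges G. card F < k \<longrightarrow> connected_graph (vertices G, edges G - F))"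

definition bridgeless :: "'a ugraph \<Rightarrow> bool" where
  "bridgeless G \<longleftrightarrow> edge_connected 2 G"

text \<open>Only the values of a colouring on the edges of the graph matter.\<close>

definition proper_edge_coloring :: "'a ugraph \<Rightarrow> nat set \<Rightarrow> ('a set \<Rightarrow> nat) \<Rightarrow> bool" where
  "proper_edge_coloring G S c \<longleftrightarrow> c ` edges G \<subseteq> S \<and>
     (\<forall>e\<in>edges G. \<forall>f\<in>edges G. e \<noteq> f \<and> e \<inter> f \<noteq> {} \<longrightarrow> c e \<noteq> c f)"

definition chromatic_index :: "'a ugraph \<Rightarrow> nat" where
  "chromatic_index G = (LEAST k. \<exists>c. proper_edge_coloring G {1..k} c)"

definition two_simultaneous_edge_coloring ::
    "'a ugraph \<Rightarrow> nat \<Rightarrow> ('a set \<Rightarrow> nat) \<Rightarrow> ('a set \<Rightarrow> nat) \<Rightarrow> bool" where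
  "two_simultaneous_edge_coloring G l c1 c2 \<longleftrightarrow>
     proper_edge_coloring G {1..l} c1 \<and> proper_edge_coloring G {1..l} c2 \<and>
     (\<forall>v\<in>vertices G. c1 ` incident_edges G v = c2 ` incident_edges G v) \<and>
     (\<forall>e\<in>edges G. c1 e \<noteq> c2 e)"

definition two_simultaneous_edge_colorable :: "'a ugraph \<Rightarrow> bool" where
  "two_simultaneous_edge_colorable G \<longleftrightarrow> (\<exists>l c1 c2. two_simultaneous_edge_coloring G l c1 c2)"

definition circuit_of :: "'a ugraph \<Rightarrow> 'a ugraph \<Rightarrow> bool" where
  "circuit_of H G \<longleftrightarrow> subgraph_of H G \<and> connected_graph H \<and> regular_graph 2 H"

text \<open>
  A collection of circuits may contain a circuit more than once, and the copies may be put into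
  different classes and be coloured differently. Collections are therefore lists, and the members
  of a collection \<open>C\<close> are addressed by their positions \<open>i < length C\<close>; the order is irrelevant.
\<close>

definition cycle_double_cover :: "'a ugraph \<Rightarrow> 'a ugraph list \<Rightarrow> bool" where
  "cycle_double_cover G C \<longleftrightarrow> (\<forall>H\<in>set C. circuit_of H G) \<and>
     (\<forall>e\<in>edges G. card {i. i < length C \<and> e \<in> edges (C ! i)} = 2)"

definition even_circuits :: "'a ugraph list \<Rightarrow> bool" where
  "even_circuits C \<longleftrightarrow> (\<forall>H\<in>set C. even (card (edges H)))"

definition graph_union :: "'a ugraph set \<Rightarrow> 'a ugraph" where
  "graph_union \<H> = (\<Union> (vertices ` \<H>), \<Union> (edges ` \<H>))"

definition two_regular_partition :: "'a ugraph \<Rightarrow> 'a ugraph list \<Rightarrow> nat set set \<Rightarrow> bool" where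
  "two_regular_partition G C P \<longleftrightarrow> partition_on {..<length C} P \<and>
     (\<forall>I\<in>P. subgraph_of (graph_union ((!) C ` I)) G \<and>
            regular_graph 2 (graph_union ((!) C ` I)))"

definition compatible_circuit_colorings ::
    "'a ugraph \<Rightarrow> 'a ugraph list \<Rightarrow> (nat \<Rightarrow> 'a set \<Rightarrow> nat) \<Rightarrow> bool" where
  "compatible_circuit_colorings G C d \<longleftrightarrow>
     (\<forall>i<length C. proper_edge_coloring (C ! i) {1, 2} (d i)) \<and>
     (\<forall>e\<in>edges G. \<forall>i<length C. \<forall>j<length C.
        i \<noteq> j \<and> e \<in> edges (C ! i) \<and> e \<in> edges (C ! j) \<longrightarrow> d i e \<noteq> d j e)"

end

theory Submission imports Defs begin

text \<open>
  For a colour \<open>i\<close> the edges \<open>e\<close> with \<open>c1 e = i\<close> or \<open>c2 e = i\<close> form a 2-regular graph in which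
  the two kinds of edges alternate, and every edge \<open>e\<close> lies in exactly the two graphs of the
  colours \<open>c1 e\<close> and \<open>c2 e\<close>; the connected components of these graphs form the cover, with one
  class per colour. Conversely, give \<open>e\<close> as first and second colour the index of the circuit in
  which \<open>e\<close> is coloured 1 and 2, respectively: the colours seen at \<open>v\<close> are then, both times, the
  circuits through \<open>v\<close>.
\<close>

section \<open>Connected components\<close>

definition adjacency :: "'a ugraph \<Rightarrow> ('a \<times> 'a) set" where
  "adjacency H = {(x, y). {x, y} \<in> edges H}"

text \<open>An edge only has to meet the reachable set, so a vertex of the component keeps all its
  edges in \<open>H\<close> and with them its degree. That no edge leaves the set of a simple graph
  is a separate fact, \<open>edge_subset_component\<close>.\<close>

definition component :: "'a ugraph \<Rightarrow> 'a \<Rightarrow> 'a ugraph" where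
  "component H v =
     ((adjacency H)\<^sup>* `` {v}, {e \<in> edges H. e \<inter> (adjacency H)\<^sup>* `` {v} \<noteq> {}})"

lemma sym_adjacency_rtrancl: "sym ((adjacency H)\<^sup>*)"
  by (rule sym_rtrancl) (auto simp: sym_def adjacency_def insert_commute)

lemma simple_graph_finite_edges:
  assumes "simple_graph G"
  shows "finite (edges G)"
proof -
  have "edges G \<subseteq> Pow (vertices G)" "finite (vertices G)"
    using assms by (auto simp: simple_graph_def)
  then show ?thesis by (meson finite_Pow_iff finite_subset)
qed

lemma simple_graph_edgeE:
  assumes "simple_graph G" "e \<in> edges G"
  obtains x y where "e = {x, y}" "x \<noteq> y" "x \<in> vertices G" "y \<in> vertices G"
  using assms unfolding simple_graph_def by (metis card_2_iff insert_subset)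

lemma reachable_vertex:
  assumes "simple_graph H" "v \<in> vertices H" "(v, u) \<in> (adjacency H)\<^sup>*"
  shows "u \<in> vertices H"
  using assms(3,2)
proof (induction rule: rtrancl_induct)
  case (step y z)
  then show ?case using assms(1) by (auto simp: adjacency_def simple_graph_def)
qed

lemma edge_subset_component:
  assumes "simple_graph H" "e \<in> edges (component H v)"
  shows "e \<subseteq> vertices (component H v)"
proof -
  have e: "e \<in> edges H" using assms(2) by (simp add: component_def)
  obtain x y where xy: "e = {x, y}" using simple_graph_edgeE[OF assms(1) e] by metis
  have "(x, y) \<in> adjacency H" "(y, x) \<in> adjacency H"
    using e xy by (auto simp: adjacency_def insert_commute)
  then show ?thesis using assms(2) xy
    by (auto simp: component_def intro: rtrancl_into_rtrancl)
qed

lemma component_subgraph: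
  assumes "simple_graph H" "v \<in> vertices H"
  shows "subgraph_of (component H v) H"
proof -
  have sub: "vertices (component H v) \<subseteq> vertices H"
    using reachable_vertex[OF assms] by (auto simp: component_def)
  have "edges (component H v) \<subseteq> edges H" by (auto simp: component_def)
  moreover have "simple_graph (component H v)"
    using sub edge_subset_component[OF assms(1)] assms(1) \<open>edges (component H v) \<subseteq> edges H\<close>
    by (auto simp: simple_graph_def intro: finite_subset)
  ultimately show ?thesis using sub by (simp add: subgraph_of_def)
qed

lemma component_regular:
  assumes "simple_graph H" "v \<in> vertices H" "regular_graph k H"
  shows "regular_graph k (component H v)"
  unfolding regular_graph_def
proof
  fix u assume u: "u \<in> vertices (component H v)"
  then have "incident_edges (component H v) u = incident_edges H u"
    by (auto simp: incident_edges_def component_def)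
  moreover have "u \<in> vertices H"
    using u component_subgraph[OF assms(1,2)] by (auto simp: subgraph_of_def)
  ultimately show "card (incident_edges (component H v) u) = k"
    using assms(3) by (simp add: regular_graph_def)
qed

lemma component_connected: "connected_graph (component H v)"
proof -
  \<comment> \<open>Every edge on a path from \<open>v\<close> meets the reachable set, so the whole
    path lies in the component. By symmetry any two vertices of the component are then joined
    through \<open>v\<close>.\<close>
  have reach: "(v, u) \<in> (adjacency (component H v))\<^sup>*" if "(v, u) \<in> (adjacency H)\<^sup>*" for u
    using that
  proof (induction rule: rtrancl_induct)
    case (step y z)
    have "(y, z) \<in> adjacency (component H v)"
      using step.hyps by (auto simp: adjacency_def component_def)
    then show ?case using step.IH by (rule rtrancl_into_rtrancl[rotated])
  qed simp
  have "(u, w) \<in> (adjacency (component H v))\<^sup>*"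
    if "u \<in> vertices (component H v)" "w \<in> vertices (component H v)" for u w
  proof -
    have "(v, u) \<in> (adjacency (component H v))\<^sup>*" "(v, w) \<in> (adjacency (component H v))\<^sup>*"
      using that reach by (auto simp: component_def)
    then show ?thesis
      using sym_adjacency_rtrancl by (meson rtrancl_trans symD)
  qed
  moreover have "v \<in> vertices (component H v)" by (simp add: component_def)
  ultimately show ?thesis by (auto simp: connected_graph_def adjacency_def)
qed

lemma component_circuit:
  assumes "simple_graph H" "regular_graph 2 H" "v \<in> vertices H"
  shows "circuit_of (component H v) H"
  by (simp add: circuit_of_def component_subgraph component_regular component_connected assms)

lemma component_cong:
  assumes "(u, v) \<in> (adjacency H)\<^sup>*"
  shows "component H u = component H v"
proof -
  have "(v, u) \<in> (adjacency H)\<^sup>*" using assms sym_adjacency_rtrancl by (meson symD)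
  then have "(adjacency H)\<^sup>* `` {u} = (adjacency H)\<^sup>* `` {v}"
    using assms by (auto intro: rtrancl_trans)
  then show ?thesis by (simp add: component_def)
qed

text \<open>Turns membership of an edge into equality of components: each edge lies in exactly one
  component of \<open>H\<close>. The count of circuits through an edge rests on this.\<close>

lemma component_of_edge:
  assumes "simple_graph H" "e \<in> edges H" "x \<in> e"
  shows "e \<in> edges (component H v) \<longleftrightarrow> component H v = component H x"
proof
  assume "e \<in> edges (component H v)"
  then have "(v, x) \<in> (adjacency H)\<^sup>*"
    using edge_subset_component[OF assms(1)] assms(3) by (auto simp: component_def)
  then show "component H v = component H x" by (rule component_cong)
next
  assume "component H v = component H x"
  then show "e \<in> edges (component H v)" using assms by (auto simp: component_def)
qed

text \<open>The class of a colour will consist of all components of its graph; its union is then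
  that graph again, hence 2-regular.\<close>

lemma graph_union_components:
  assumes "simple_graph H"
  shows "graph_union (component H ` vertices H) = H"
proof -
  have 1: "(\<Union>v\<in>vertices H. vertices (component H v)) = vertices H"
    using reachable_vertex[OF assms] by (auto simp: component_def)
  have 2: "(\<Union>v\<in>vertices H. edges (component H v)) = edges H"
  proof
    show "edges H \<subseteq> (\<Union>v\<in>vertices H. edges (component H v))"
    proof
      fix e assume e: "e \<in> edges H"
      then obtain x y where "e = {x, y}" "x \<in> vertices H"
        using simple_graph_edgeE[OF assms] by metis
      then show "e \<in> (\<Union>v\<in>vertices H. edges (component H v))"
        using component_of_edge[OF assms e] by blast
    qed
  qed (auto simp: component_def)
  show ?thesis using 1 2 by (simp add: graph_union_def image_image prod_eq_iff)
qed

section \<open>Properly 2-coloured 2-regular graphs\<close>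

text \<open>Serves twice: for the two edges at a vertex of a 2-regular graph, and for the two
  circuits through an edge, where the colour varies with the circuit.\<close>

lemma ex1_of_two_colors:
  fixes d :: "'b \<Rightarrow> nat"
  assumes "d x \<noteq> d y" "d x \<in> {1, 2}" "d y \<in> {1, 2}" "k = 1 \<or> k = 2"
  shows "\<exists>!z. (z = x \<or> z = y) \<and> d z = k"
proof (cases "d x = k")
  case True
  then show ?thesis using assms(1) by (intro ex1I[of _ x]) auto
next
  case False
  then have "d y = k" using assms by auto
  then show ?thesis using False by (intro ex1I[of _ y]) auto
qed

text \<open>The two edges at \<open>v\<close> meet there, so a proper colouring with 1 and 2 uses
  each colour once.\<close>

lemma two_regular_alternating:
  assumes "regular_graph 2 H" "proper_edge_coloring H {1, 2} d" "v \<in> vertices H"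
    and "k = 1 \<or> k = 2"
  shows "\<exists>!e. e \<in> edges H \<and> v \<in> e \<and> d e = k"
proof -
  have "card (incident_edges H v) = 2" using assms by (simp add: regular_graph_def)
  then obtain e f where ef: "incident_edges H v = {e, f}" "e \<noteq> f" by (auto simp: card_2_iff)
  have inc: "g \<in> edges H \<and> v \<in> g \<longleftrightarrow> g = e \<or> g = f" for g
    using ef(1) by (auto simp: incident_edges_def)
  have mem: "e \<in> edges H" "v \<in> e" "f \<in> edges H" "v \<in> f"
    using inc[of e] inc[of f] by simp_all
  then have "e \<inter> f \<noteq> {}" by blast
  then have "d e \<noteq> d f"
    using mem assms(2) ef(2) by (simp add: proper_edge_coloring_def)
  moreover have "d e \<in> {1, 2}" "d f \<in> {1, 2}"
    using mem assms(2) unfolding proper_edge_coloring_def by blast+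
  ultimately have "\<exists>!g. (g = e \<or> g = f) \<and> d g = k"
    using assms(4) by (rule ex1_of_two_colors)
  moreover have "g \<in> edges H \<and> v \<in> g \<and> d g = k \<longleftrightarrow> (g = e \<or> g = f) \<and> d g = k" for g
    using inc by blast
  ultimately show ?thesis by simp
qed

text \<open>Two perfect matchings of the same vertex set have equally many edges, and the two colour
  classes together make up the edge set.\<close>

lemma two_regular_bipartite_even:
  assumes "simple_graph H" "regular_graph 2 H" "proper_edge_coloring H {1, 2} d"
  shows "even (card (edges H))"
proof -
  define M where "M k = {e \<in> edges H. d e = k}" for k
  have fin: "finite (edges H)" by (rule simple_graph_finite_edges[OF assms(1)])
  have sub: "e \<subseteq> vertices H" "card e = 2" if "e \<in> edges H" for e
    using that assms(1) by (auto simp: simple_graph_def)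
  \<comment> \<open>both colour classes are perfect matchings\<close>
  have matching: "2 * card (M k) = card (vertices H)" if k: "k = 1 \<or> k = 2" for k
  proof -
    have alt: "\<exists>!e. e \<in> M k \<and> v \<in> e" if "v \<in> vertices H" for v
      using two_regular_alternating[OF assms(2,3) that k] by (auto simp: M_def)
    have U: "\<Union> (M k) = vertices H"
      using alt sub(1) by (fastforce simp: M_def)
    have "2 * card (M k) = card (\<Union> (M k))"
    proof (rule card_partition)
      show "finite (M k)" using fin by (simp add: M_def)
      show "finite (\<Union> (M k))" using assms(1) U by (simp add: simple_graph_def)
      show "card c = 2" if "c \<in> M k" for c using that sub by (simp add: M_def)
      show "c \<inter> c' = {}" if "c \<in> M k" "c' \<in> M k" "c \<noteq> c'" for c c'
        using that alt U by blast
    qed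
    then show ?thesis using U by simp
  qed
  have "edges H = M 1 \<union> M 2"
    using assms(3) by (auto simp: M_def proper_edge_coloring_def)
  moreover have "M 1 \<inter> M 2 = {}" "finite (M 1)" "finite (M 2)"
    using fin by (auto simp: M_def)
  ultimately have "card (edges H) = card (M 1) + card (M 2)"
    by (simp add: card_Un_disjoint)
  moreover have "card (M 1) = card (M 2)" using matching[of 1] matching[of 2] by simp
  ultimately show ?thesis by simp
qed

lemma proper_edge_coloring_subgraph:
  assumes "subgraph_of K H" "proper_edge_coloring H S d"
  shows "proper_edge_coloring K S d"
proof -
  have "edges K \<subseteq> edges H" using assms(1) by (simp add: subgraph_of_def)
  then show ?thesis using assms(2) by (auto simp: proper_edge_coloring_def subset_iff)
qed

section \<open>From a double cover to a simultaneous colouring\<close>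

lemma two_simultaneous_edge_colorable_if_cover:
  assumes G: "simple_graph G" and C: "cycle_double_cover G C"
    and d: "compatible_circuit_colorings G C d"
  shows "two_simultaneous_edge_colorable G"
proof -
  have circ: "subgraph_of (C ! i) G" "regular_graph 2 (C ! i)" if "i < length C" for i
    using C that by (auto simp: cycle_double_cover_def circuit_of_def)
  have proper_d: "proper_edge_coloring (C ! i) {1, 2} (d i)" if "i < length C" for i
    using d that by (simp add: compatible_circuit_colorings_def)
  define occ where "occ e k i \<longleftrightarrow> i < length C \<and> e \<in> edges (C ! i) \<and> d i e = k" for e k i
  \<comment> \<open>Exactly two positions of the cover contain \<open>e\<close>, and they give it
    different colours from {1, 2}, so one of them gives it \<open>k\<close>.\<close>
  have occ_ex1: "\<exists>!i. occ e k i" if e: "e \<in> edges G" and k: "k = 1 \<or> k = 2" for e k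
  proof -
    have "card {i. i < length C \<and> e \<in> edges (C ! i)} = 2"
      using C e by (simp add: cycle_double_cover_def)
    then obtain i j where ij: "{i. i < length C \<and> e \<in> edges (C ! i)} = {i, j}" "i \<noteq> j"
      by (auto simp: card_2_iff)
    then have mem: "h < length C \<and> e \<in> edges (C ! h) \<longleftrightarrow> h = i \<or> h = j" for h by auto
    have "d i e \<noteq> d j e"
      using d e mem[of i] mem[of j] ij(2) unfolding compatible_circuit_colorings_def by simp
    moreover have "d i e \<in> {1, 2}" "d j e \<in> {1, 2}"
      using proper_d[of i] proper_d[of j] mem[of i] mem[of j] unfolding proper_edge_coloring_def by blast+
    ultimately have "\<exists>!h. (h = i \<or> h = j) \<and> d h e = k"
      using k by (rule ex1_of_two_colors[where d = "\<lambda>h. d h e"])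
    moreover have "occ e k h \<longleftrightarrow> (h = i \<or> h = j) \<and> d h e = k" for h
      using mem unfolding occ_def by blast
    ultimately show ?thesis by simp
  qed
  \<comment> \<open>positions start at 0, colours at 1\<close>
  define col where "col k e = Suc (THE i. occ e k i)" for k e
  \<comment> \<open>Unique existence turns the definite description into an equivalence; from here
    on \<open>col\<close> is used through it and not through its definition.\<close>
  have col: "col k e = Suc i \<longleftrightarrow> occ e k i" if e: "e \<in> edges G" and k: "k = 1 \<or> k = 2" for e k i
  proof -
    obtain j where j: "occ e k j" "\<And>h. occ e k h \<Longrightarrow> h = j"
      using occ_ex1[OF e k] by blast
    then have "(THE i. occ e k i) = j" by (rule the_equality)
    then have "col k e = Suc i \<longleftrightarrow> j = i" by (simp add: col_def)
    also have "\<dots> \<longleftrightarrow> occ e k i" using j by blast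
    finally show ?thesis .
  qed
  have colE: "\<exists>i. col k e = Suc i \<and> occ e k i" if "e \<in> edges G" "k = 1 \<or> k = 2" for e k
    using occ_ex1[OF that] col[OF that] by metis
  have proper: "proper_edge_coloring G {1..length C} (col k)" if k: "k = 1 \<or> k = 2" for k
    unfolding proper_edge_coloring_def
  proof (intro conjI ballI impI)
    show "col k ` edges G \<subseteq> {1..length C}"
    proof clarify
      fix e assume "e \<in> edges G"
      from colE[OF this k] show "col k e \<in> {1..length C}" by (auto simp: occ_def)
    qed
  next
    fix e f assume e: "e \<in> edges G" and f: "f \<in> edges G" and ef: "e \<noteq> f \<and> e \<inter> f \<noteq> {}"
    \<comment> \<open>A common colour would mean that one circuit contains both edges and colours
      both with \<open>k\<close>, although they meet.\<close>
    show "col k e \<noteq> col k f"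
    proof
      assume "col k e = col k f"
      then obtain i where "occ e k i" "occ f k i" using colE[OF e k] col[OF f k] by metis
      then show False using proper_d[of i] ef by (auto simp: occ_def proper_edge_coloring_def)
    qed
  qed
  \<comment> \<open>The right-hand side does not mention \<open>k\<close>, which yields equal colour
    sets at every vertex. An edge with colour \<open>Suc i\<close> lies on circuit \<open>i\<close>;
    conversely a circuit through \<open>v\<close> alternates there and so has an edge coloured
    \<open>k\<close> at \<open>v\<close>.\<close>
  have seen: "col k ` incident_edges G v = {Suc i | i. i < length C \<and> v \<in> vertices (C ! i)}"
    if k: "k = 1 \<or> k = 2" for k v
  proof (intro equalityI subsetI)
    fix c assume "c \<in> col k ` incident_edges G v"
    then obtain e where e: "e \<in> edges G" "v \<in> e" "c = col k e" by (auto simp: incident_edges_def)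
    then obtain i where i: "c = Suc i" "occ e k i" using colE[OF e(1) k] by auto
    then have "v \<in> vertices (C ! i)"
      using circ(1)[of i] e(2) by (auto simp: occ_def subgraph_of_def simple_graph_def)
    then show "c \<in> {Suc i | i. i < length C \<and> v \<in> vertices (C ! i)}"
      using i by (auto simp: occ_def)
  next
    fix c assume "c \<in> {Suc i | i. i < length C \<and> v \<in> vertices (C ! i)}"
    then obtain i where i: "c = Suc i" "i < length C" "v \<in> vertices (C ! i)" by auto
    then obtain e where e: "e \<in> edges (C ! i)" "v \<in> e" "d i e = k"
      using two_regular_alternating[OF circ(2)[OF i(2)] proper_d[OF i(2)] i(3) k] by blast
    have "e \<in> edges G" using circ(1)[OF i(2)] e(1) by (auto simp: subgraph_of_def)
    moreover from this have "col k e = c" using col[OF _ k] i e by (simp add: occ_def)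
    ultimately show "c \<in> col k ` incident_edges G v" using e(2) by (auto simp: incident_edges_def)
  qed
  \<comment> \<open>Otherwise the same circuit would give \<open>e\<close> both colours 1 and
    2.\<close>
  have neq: "col 1 e \<noteq> col 2 e" if e: "e \<in> edges G" for e
  proof
    assume "col 1 e = col 2 e"
    moreover obtain i where i: "col 1 e = Suc i" "occ e 1 i" using colE[OF e, of 1] by auto
    ultimately have "occ e 2 i" using col[OF e, of 2] by simp
    then show False using i(2) by (simp add: occ_def)
  qed
  have "two_simultaneous_edge_coloring G (length C) (col 1) (col 2)"
    unfolding two_simultaneous_edge_coloring_def
  proof (intro conjI ballI)
    show "col 1 ` incident_edges G v = col 2 ` incident_edges G v" for v
      using seen[of 1 v] seen[of 2 v] by simp
  qed (simp_all only: proper neq simp_thms)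
  then show ?thesis unfolding two_simultaneous_edge_colorable_def by (intro exI)
qed

section \<open>From a simultaneous colouring to a double cover\<close>

lemma proper_edge_coloring_inj_at:
  assumes "proper_edge_coloring G S c" "e \<in> edges G" "f \<in> edges G" "v \<in> e" "v \<in> f" "c e = c f"
  shows "e = f"
proof (rule ccontr)
  assume "e \<noteq> f"
  moreover have "e \<inter> f \<noteq> {}" using assms(4,5) by blast
  ultimately show False using assms by (simp add: proper_edge_coloring_def)
qed

text \<open>The colours that occur may have gaps; a bijection renames them to an initial segment
  starting at 1. As each occurring colour will give one class, this supplies the lower bound on the
  number of classes.\<close>

lemma chromatic_index_le_card_image:
  assumes "simple_graph G" "proper_edge_coloring G S c"
  shows "chromatic_index G \<le> card (c ` edges G)"
proof -
  have "finite (c ` edges G)" using simple_graph_finite_edges[OF assms(1)] by simp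
  then obtain h where h: "bij_betw h (c ` edges G) {1..card (c ` edges G)}"
    by (metis finite_same_card_bij card_atLeastAtMost diff_Suc_1 finite_atLeastAtMost)
  have "proper_edge_coloring G {1..card (c ` edges G)} (h \<circ> c)"
    unfolding proper_edge_coloring_def
  proof (intro conjI ballI impI)
    show "(h \<circ> c) ` edges G \<subseteq> {1..card (c ` edges G)}"
      using h by (auto simp: bij_betw_def)
    fix e f assume "e \<in> edges G" "f \<in> edges G" "e \<noteq> f \<and> e \<inter> f \<noteq> {}"
    moreover from this have "c e \<noteq> c f"
      using assms(2) by (auto simp: proper_edge_coloring_def)
    ultimately show "(h \<circ> c) e \<noteq> (h \<circ> c) f"
      using h by (auto simp: bij_betw_def dest: inj_onD)
  qed
  then show ?thesis unfolding chromatic_index_def by (intro Least_le exI)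
qed

text \<open>Only the ends of the selected edges are vertices. All of \<open>vertices G\<close> would
  add vertices of degree 0 wherever the colour is not seen.\<close>

definition color_graph :: "'a ugraph \<Rightarrow> ('a set \<Rightarrow> nat) \<Rightarrow> ('a set \<Rightarrow> nat) \<Rightarrow> nat \<Rightarrow> 'a ugraph" where
  "color_graph G c1 c2 i =
     (\<Union> {e \<in> edges G. c1 e = i \<or> c2 e = i}, {e \<in> edges G. c1 e = i \<or> c2 e = i})"

context
  fixes G :: "'a ugraph" and l c1 c2
  assumes G: "simple_graph G" and col: "two_simultaneous_edge_coloring G l c1 c2"
begin

lemma proper1: "proper_edge_coloring G {1..l} c1" and proper2: "proper_edge_coloring G {1..l} c2"
  using col by (simp_all add: two_simultaneous_edge_coloring_def)

lemma color_graph_subgraph: "subgraph_of (color_graph G c1 c2 i) G"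
  using G unfolding subgraph_of_def simple_graph_def color_graph_def
  by (auto intro: finite_subset)

text \<open>A colour seen at \<open>v\<close> under one colouring is seen there under the other too,
  on exactly one edge each by properness. These two edges differ because no edge has the same colour
  under both.\<close>

lemma color_graph_regular: "regular_graph 2 (color_graph G c1 c2 i)"
  unfolding regular_graph_def
proof
  fix v assume "v \<in> vertices (color_graph G c1 c2 i)"
  then obtain g where g: "g \<in> edges G" "v \<in> g" "c1 g = i \<or> c2 g = i"
    by (auto simp: color_graph_def)
  have v: "v \<in> vertices G" using g G by (auto simp: simple_graph_def)
  have same: "c1 ` incident_edges G v = c2 ` incident_edges G v"
    using col v by (simp add: two_simultaneous_edge_coloring_def)
  have "i \<in> c1 ` incident_edges G v \<or> i \<in> c2 ` incident_edges G v"
    using g by (auto simp: incident_edges_def)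
  then have "i \<in> c1 ` incident_edges G v" "i \<in> c2 ` incident_edges G v"
    using same by simp_all
  then obtain e f where e: "e \<in> edges G" "v \<in> e" "c1 e = i"
    and f: "f \<in> edges G" "v \<in> f" "c2 f = i"
    by (auto simp: incident_edges_def)
  have "e \<noteq> f" using e f col by (auto simp: two_simultaneous_edge_coloring_def)
  have he: "h = e" if "h \<in> edges G" "v \<in> h" "c1 h = i" for h
    using proper_edge_coloring_inj_at[OF proper1 that(1) e(1) that(2) e(2)] that(3) e(3) by simp
  have hf: "h = f" if "h \<in> edges G" "v \<in> h" "c2 h = i" for h
    using proper_edge_coloring_inj_at[OF proper2 that(1) f(1) that(2) f(2)] that(3) f(3) by simp
  have "incident_edges (color_graph G c1 c2 i) v = {e, f}"
  proof (intro equalityI subsetI)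
    fix h assume "h \<in> incident_edges (color_graph G c1 c2 i) v"
    then have "h \<in> edges G" "v \<in> h" "c1 h = i \<or> c2 h = i"
      by (simp_all add: incident_edges_def color_graph_def)
    then show "h \<in> {e, f}" using he hf by blast
  qed (use e f in \<open>auto simp: incident_edges_def color_graph_def\<close>)
  then show "card (incident_edges (color_graph G c1 c2 i) v) = 2"
    using \<open>e \<noteq> f\<close> by simp
qed

text \<open>Two meeting edges cannot both receive \<open>i\<close> from the same colouring. The else
  branch stands for \<open>c2 e = i\<close>, since an edge of this graph has \<open>i\<close> as one
  of its two colours.\<close>

lemma color_graph_proper:
  "proper_edge_coloring (color_graph G c1 c2 i) {1, 2} (\<lambda>e. if c1 e = i then 1 else 2)"
proof -
  have "e = f"
    if "e \<in> edges G" "f \<in> edges G" "v \<in> e" "v \<in> f" "c1 e = c1 f \<or> c2 e = c2 f" for e f v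
    using that proper_edge_coloring_inj_at[OF proper1] proper_edge_coloring_inj_at[OF proper2]
    by meson
  then have "c1 e \<noteq> c1 f \<and> c2 e \<noteq> c2 f"
    if "e \<in> edges G" "f \<in> edges G" "e \<noteq> f \<and> e \<inter> f \<noteq> {}" for e f
    using that by (metis disjoint_iff)
  then show ?thesis
    unfolding proper_edge_coloring_def
    by (simp add: color_graph_def image_subset_iff) metis
qed

text \<open>Every edge is incident to a vertex, so agreement at the vertices carries over to the
  whole graph. Indexing by the colours of \<open>c1\<close> therefore misses no colour of
  \<open>c2\<close>.\<close>

lemma colors_agree: "c2 ` edges G = c1 ` edges G"
proof -
  have E: "edges G = (\<Union>v\<in>vertices G. incident_edges G v)"
  proof (intro equalityI subsetI)
    fix e assume e: "e \<in> edges G"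
    then obtain x y where "e = {x, y}" "x \<in> vertices G" using simple_graph_edgeE[OF G] by metis
    with e show "e \<in> (\<Union>v\<in>vertices G. incident_edges G v)"
      by (auto simp: incident_edges_def)
  qed (auto simp: incident_edges_def)
  have "c2 ` incident_edges G v = c1 ` incident_edges G v" if "v \<in> vertices G" for v
    using col that by (simp add: two_simultaneous_edge_coloring_def)
  then show ?thesis by (subst (1 2) E) (simp add: image_UN)
qed

lemma cover_if_two_simultaneous_edge_coloring:
  "\<exists>C. cycle_double_cover G C \<and> even_circuits C \<and>
     (\<exists>P. two_regular_partition G C P \<and> card P \<ge> chromatic_index G) \<and>
     (\<exists>d. compatible_circuit_colorings G C d)"
proof -
  define H where "H = color_graph G c1 c2"
  have subH: "subgraph_of (H i) G" and simple: "simple_graph (H i)" and reg: "regular_graph 2 (H i)"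
    and proper: "proper_edge_coloring (H i) {1, 2} (\<lambda>e. if c1 e = i then 1 else 2)" for i
    unfolding H_def using color_graph_subgraph color_graph_regular color_graph_proper
    by (auto simp: subgraph_of_def)
  have edgesH: "e \<in> edges (H i) \<longleftrightarrow> e \<in> edges G \<and> (i = c1 e \<or> i = c2 e)" for e i
    by (auto simp: H_def color_graph_def)
  have neq: "c1 e \<noteq> c2 e" if "e \<in> edges G" for e
    using col that by (simp add: two_simultaneous_edge_coloring_def)
  \<comment> \<open>Restricting to colours that occur keeps every class nonempty, as a partition
    demands.\<close>
  define A where "A = c1 ` edges G"
  \<comment> \<open>A circuit may be a component for two colours, hence the tagging by colours.\<close>
  define S where "S = (SIGMA i:A. component (H i) ` vertices (H i))"
  have "finite S"
    unfolding S_def A_def using simple simple_graph_finite_edges[OF G]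
    by (auto simp: simple_graph_def)
  then obtain xs where xs: "set xs = S" "distinct xs" using finite_distinct_list by blast
  \<comment> \<open>Dropping the tags may leave equal circuits at different positions; the colour of
    position \<open>j\<close> is still available as \<open>fst (xs ! j)\<close>, and
    \<open>d\<close> reads it to tell whether \<open>e\<close> has this colour under
    \<open>c1\<close> or under \<open>c2\<close>.\<close>
  define C where "C = map snd xs"
  define d where "d j e = (if c1 e = fst (xs ! j) then 1 else 2 :: nat)" for j e
  have lenC: "length C = length xs" by (simp add: C_def)
  have nth: "\<exists>i\<in>A. \<exists>v\<in>vertices (H i). xs ! j = (i, component (H i) v) \<and> C ! j = component (H i) v"
    if "j < length xs" for j
  proof -
    have "xs ! j \<in> S" using that xs(1) nth_mem by blast
    then show ?thesis using that by (auto simp: S_def C_def)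
  qed
  have circ: "circuit_of (C ! j) (H (fst (xs ! j)))" if "j < length xs" for j
    using nth[OF that] component_circuit simple reg by fastforce
  have circG: "circuit_of (C ! j) G" if "j < length xs" for j
    using circ[OF that] subH[of "fst (xs ! j)"] by (auto simp: circuit_of_def subgraph_of_def)
  have properC: "proper_edge_coloring (C ! j) {1, 2} (d j)" if "j < length xs" for j
    unfolding d_def using circ[OF that] proper proper_edge_coloring_subgraph
    unfolding circuit_of_def by blast
  \<comment> \<open>Among the colour graphs only those of \<open>c1 e\<close> and
    \<open>c2 e\<close> contain \<open>e\<close>, and within each only the component of
    \<open>x\<close> does. The tags keep the two pairs distinct even if the components
    coincide.\<close>
  have tagged: "{p \<in> S. e \<in> edges (snd p)} =
      {(c1 e, component (H (c1 e)) x), (c2 e, component (H (c2 e)) x)}"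
    if e: "e \<in> edges G" "x \<in> e" for e x
  proof -
    have "c1 e \<in> A" "c2 e \<in> A" using e(1) colors_agree by (auto simp: A_def)
    moreover have "x \<in> vertices (H (c1 e))" "x \<in> vertices (H (c2 e))"
      using e by (auto simp: H_def color_graph_def)
    moreover have "e \<in> edges (component (H i) v) \<longleftrightarrow>
        (i = c1 e \<or> i = c2 e) \<and> component (H i) v = component (H i) x" for i v
    proof (cases "e \<in> edges (H i)")
      case True
      then show ?thesis using component_of_edge[OF simple True e(2)] edgesH by blast
    next
      case False
      then show ?thesis using edgesH e(1) by (auto simp: component_def)
    qed
    ultimately show ?thesis by (auto simp: S_def)
  qed
  have cover: "cycle_double_cover G C"
    unfolding cycle_double_cover_def
  proof (intro conjI ballI)
    show "circuit_of K G" if "K \<in> set C" for K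
      using that circG lenC by (metis in_set_conv_nth)
    fix e assume e: "e \<in> edges G"
    obtain x where x: "x \<in> e" using simple_graph_edgeE[OF G e] by blast
    let ?J = "{j. j < length C \<and> e \<in> edges (C ! j)}"
    \<comment> \<open>Since \<open>xs\<close> is distinct, counting positions amounts to counting
      tagged circuits, which \<open>tagged\<close> determines.\<close>
    have "inj_on ((!) xs) ?J" using xs(2) lenC by (auto simp: inj_on_def nth_eq_iff_index_eq)
    moreover have "(!) xs ` ?J = {p \<in> S. e \<in> edges (snd p)}"
    proof (intro equalityI subsetI)
      fix p assume "p \<in> {p \<in> S. e \<in> edges (snd p)}"
      then obtain j where "j < length xs" "p = xs ! j" "e \<in> edges (snd p)"
        unfolding xs(1)[symmetric] by (auto simp: in_set_conv_nth)
      then show "p \<in> (!) xs ` ?J" by (simp add: C_def)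
    qed (use xs(1) in \<open>auto simp: C_def\<close>)
    ultimately have "card ?J = card {p \<in> S. e \<in> edges (snd p)}"
      using card_image by fastforce
    then show "card ?J = 2" using tagged[OF e x] neq[OF e] by simp
  qed
  have even: "even_circuits C"
    unfolding even_circuits_def
  proof
    fix K assume "K \<in> set C"
    then obtain j where "j < length xs" "K = C ! j" using lenC by (metis in_set_conv_nth)
    then show "even (card (edges K))"
      using two_regular_bipartite_even[OF _ _ properC[of j]] circG[of j]
      by (simp add: circuit_of_def subgraph_of_def)
  qed
  define I where "I i = {j. j < length xs \<and> fst (xs ! j) = i}" for i
  \<comment> \<open>The positions tagged \<open>i\<close> carry exactly the components of the graph
    of \<open>i\<close>, so the union of the class is that graph.\<close>
  have I: "(!) C ` I i = component (H i) ` vertices (H i)" if "i \<in> A" for i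
  proof -
    have "(!) C ` I i = snd ` {p \<in> S. fst p = i}"
      unfolding xs(1)[symmetric] I_def C_def by (force simp: in_set_conv_nth)
    also have "{p \<in> S. fst p = i} = {i} \<times> component (H i) ` vertices (H i)"
      using that by (auto simp: S_def)
    finally show ?thesis by simp
  qed
  have ne: "I i \<noteq> {}" if i: "i \<in> A" for i
  proof -
    obtain e where e: "e \<in> edges (H i)" using i edgesH by (auto simp: A_def)
    obtain x where "x \<in> vertices (H i)" using simple_graph_edgeE[OF simple e] by blast
    then show ?thesis using I[OF i] by auto
  qed
  \<comment> \<open>Each position has a single tag, so classes of different colours are disjoint;
    being nonempty they are different, and there are as many classes as colours.\<close>
  have "inj_on I A" using ne by (auto simp: inj_on_def I_def)
  then have "card (I ` A) = card A" by (rule card_image)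
  moreover have "chromatic_index G \<le> card A"
    unfolding A_def by (rule chromatic_index_le_card_image[OF G proper1])
  moreover have "two_regular_partition G C (I ` A)"
    unfolding two_regular_partition_def
  proof
    have "fst (xs ! j) \<in> A" if "j < length xs" for j using nth[OF that] by auto
    then show "partition_on {..<length C} (I ` A)"
      using ne by (auto simp: partition_on_def disjoint_def I_def lenC)
    show "\<forall>J\<in>I ` A. subgraph_of (graph_union ((!) C ` J)) G \<and>
        regular_graph 2 (graph_union ((!) C ` J))"
      using subH reg by (simp add: I graph_union_components[OF simple])
  qed
  moreover have "compatible_circuit_colorings G C d"
    unfolding compatible_circuit_colorings_def
  proof (intro conjI allI ballI impI)
    show "proper_edge_coloring (C ! i) {1, 2} (d i)" if "i < length C" for i
      using that properC lenC by simp
    fix e i j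
    assume e: "e \<in> edges G" and i: "i < length C" and j: "j < length C"
      and ij: "i \<noteq> j \<and> e \<in> edges (C ! i) \<and> e \<in> edges (C ! j)"
    obtain x where x: "x \<in> e" using simple_graph_edgeE[OF G e] by blast
    \<comment> \<open>Two different positions containing \<open>e\<close> must be the two tagged
      circuits, in either order. The one tagged \<open>c1 e\<close> colours \<open>e\<close> with 1,
      the one tagged \<open>c2 e\<close> with 2.\<close>
    have "xs ! i \<in> {p \<in> S. e \<in> edges (snd p)}" "xs ! j \<in> {p \<in> S. e \<in> edges (snd p)}"
      using i j ij xs(1) by (auto simp: C_def)
    moreover have "xs ! i \<noteq> xs ! j"
      using i j ij xs(2) lenC by (simp add: nth_eq_iff_index_eq)
    ultimately have "fst (xs ! i) = c1 e \<and> fst (xs ! j) = c2 e \<or>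
        fst (xs ! i) = c2 e \<and> fst (xs ! j) = c1 e"
      unfolding tagged[OF e x] by (metis fst_conv insertE singletonD)
    then show "d i e \<noteq> d j e"
      using neq[OF e] by (elim disjE conjE) (simp_all add: d_def)
  qed
  ultimately show ?thesis using cover even
    by (intro exI[of _ C] exI[of _ "I ` A"] exI[of _ d] conjI) simp_all
qed

end

theorem theorem3p4:
  fixes G :: "'a ugraph"
  assumes "simple_graph G" and "bridgeless G"
  shows "two_simultaneous_edge_colorable G \<longleftrightarrow>
    (\<exists>C. cycle_double_cover G C \<and>
         even_circuits C \<and>
         (\<exists>P. two_regular_partition G C P \<and> card P \<ge> chromatic_index G) \<and>
         (\<exists>d. compatible_circuit_colorings G C d))"
proof
  assume "two_simultaneous_edge_colorable G"
  then obtain l c1 c2 where "two_simultaneous_edge_coloring G l c1 c2"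
    unfolding two_simultaneous_edge_colorable_def by (elim exE)
  then show "\<exists>C. cycle_double_cover G C \<and> even_circuits C \<and>
      (\<exists>P. two_regular_partition G C P \<and> card P \<ge> chromatic_index G) \<and>
      (\<exists>d. compatible_circuit_colorings G C d)"
    by (rule cover_if_two_simultaneous_edge_coloring[OF assms(1)])
qed (elim exE conjE, rule two_simultaneous_edge_colorable_if_cover[OF assms(1)])

end
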